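(* Let $X$ be a finite-dimensional vector space over any field. Then there is a bijection $$\mathrm{Nil}(X) \times X \cong \mathrm{Lin}(X),$$ where $\mathrm{Nil}(X)$ is the set of nilpotent linear operators on $X$ and $\mathrm{Lin}(X)$ is the set of all linear operators on $X$.
   Context: A linear operator on $X$ is a linear map $T \colon X \to X$. It is nilpotent if $T^k = 0$ for some integer $k \geq 0$. The field is arbitrary, not necessarily finite. *)

theory Defs
  imports Complex_Main
begin

definition Lin :: "('a::field \<Rightarrow> 'b::ab_group_add \<Rightarrow> 'b) \<Rightarrow> ('b \<Rightarrow> 'b) set" where
  "Lin scale = {T. Vector_Spaces.linear scale scale T}"

definition nilpotent :: "('b::zero \<Rightarrow> 'b) \<Rightarrow> bool" where
  "nilpotent T \<longleftrightarrow> (\<exists>k::nat. T ^^ k = (\<lambda>x. 0))"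

definition Nil_ops :: "('a::field \<Rightarrow> 'b::ab_group_add \<Rightarrow> 'b) \<Rightarrow> ('b \<Rightarrow> 'b) set" where
  "Nil_ops scale = {T \<in> Lin scale. nilpotent T}"

end

theory Submission
  imports Defs
begin

text \<open>
  Both sides of the bijection are cut into pieces indexed by the subspaces \<open>W\<close> of the space, and
  corresponding pieces are matched directly. No counting is involved, so the field may be
  infinite.

  Fix \<open>W\<close> of dimension \<open>m\<close>, a basis \<open>e 0, \<dots>, e (m - 1)\<close> of \<open>W\<close>, and a set \<open>C\<close> extending it to a
  basis of the whole space.

  On the nilpotent side, the piece of \<open>W\<close> consists of the pairs \<open>(T, x)\<close> with \<open>T\<close> nilpotent whose
  orbit \<open>x, T x, T\<^sup>2 x, \<dots>\<close> spans \<open>W\<close>. By nilpotency the first \<open>m\<close> vectors of the orbit form a basis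
  of \<open>W\<close> and the next one vanishes (\<open>nilpotent_cyclic_basis\<close>). So \<open>T\<close> on \<open>W\<close>, together with \<open>x\<close>, is the
  same thing as an ordered basis of \<open>W\<close>.

  On the other side, the piece of \<open>W\<close> consists of the operators \<open>U\<close> whose iterated images eventually
  stabilise at \<open>W\<close>; every operator has exactly one such \<open>W\<close> (\<open>ex_stable_range\<close>,
  \<open>stable_range_unique\<close>), the bijective part of its Fitting decomposition. Here \<open>U\<close> restricts to an
  automorphism of \<open>W\<close>, and through its values at \<open>e 0, \<dots>, e (m - 1)\<close> this automorphism is again
  the same thing as an ordered basis of \<open>W\<close>.

  Hence \<open>(T, x)\<close> is matched with the operator \<open>U\<close> that sends \<open>e i\<close> to \<open>T\<^sup>i x\<close> for \<open>i < m\<close> and agrees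
  with \<open>T\<close> on \<open>C\<close>. The remaining conditions on the two pieces also match: \<open>T\<close> and \<open>U\<close> preserve \<open>W\<close> and
  agree on \<open>C\<close>, so they induce the same operator on the quotient by \<open>W\<close>. The operator \<open>T\<close>, being
  nilpotent on \<open>W\<close>, is nilpotent iff that quotient operator is, and this in turn says that some
  power of \<open>U\<close> maps the whole space into \<open>W\<close> (\<open>stable_range_if_correspond\<close>, \<open>correspond_surj\<close>).
\<close>

lemma funpow_image_eq:
  assumes "f ` A = A"
  shows "(f ^^ k) ` A = A"
proof (induction k)
  case (Suc k)
  have "(f ^^ Suc k) ` A = f ` (f ^^ k) ` A" by (simp add: image_image)
  then show ?case using Suc assms by simp
qed simp

context finite_dimensional_vector_space
begin

interpretation endo: vector_space_pair scale scale ..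

section \<open>The matching of pairs with operators\<close>

definition cyclic_subspace :: "('b \<Rightarrow> 'b) \<Rightarrow> 'b \<Rightarrow> 'b set" where
  "cyclic_subspace T x = span (range (\<lambda>i. (T ^^ i) x))"

text \<open>
  Such a \<open>W\<close> is the intersection of the ranges of all powers of \<open>U\<close>, and this intersection is
  attained. The second clause is invariant under changing \<open>U\<close> to another operator that preserves
  \<open>W\<close> and induces the same map on the quotient, for instance to the nilpotent partner of \<open>U\<close>.
\<close>

definition stable_range :: "('b \<Rightarrow> 'b) \<Rightarrow> 'b set \<Rightarrow> bool" where
  "stable_range U W \<longleftrightarrow> U ` W = W \<and> (\<exists>k. range (U ^^ k) \<subseteq> W)"

text \<open>
  The basis of \<open>W\<close> is ordered, since it is compared with the orbit of a vector. For the vectors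
  \<open>C\<close> that extend it to a basis of the whole space a set is enough.
\<close>

definition adapted_basis :: "'b set \<Rightarrow> (nat \<Rightarrow> 'b) \<Rightarrow> 'b set \<Rightarrow> bool" where
  "adapted_basis W e C \<longleftrightarrow>
     inj_on e {..<dim W} \<and> span (e ` {..<dim W}) = W \<and>
     e ` {..<dim W} \<inter> C = {} \<and>
     independent (e ` {..<dim W} \<union> C) \<and> span (e ` {..<dim W} \<union> C) = UNIV"

definition correspond ::
    "'b set \<Rightarrow> (nat \<Rightarrow> 'b) \<Rightarrow> 'b set \<Rightarrow> ('b \<Rightarrow> 'b) \<Rightarrow> 'b \<Rightarrow> ('b \<Rightarrow> 'b) \<Rightarrow> bool" where
  "correspond W e C T x U \<longleftrightarrow>
     (\<forall>i<dim W. U (e i) = (T ^^ i) x) \<and> (\<forall>c\<in>C. U c = T c)"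

lemma linear_funpow:
  assumes "Vector_Spaces.linear scale scale T"
  shows "Vector_Spaces.linear scale scale (T ^^ i)"
proof (induction i)
  case 0
  then show ?case by (simp add: linear_ident id_def)
next
  case (Suc i)
  then show ?case using assms Vector_Spaces.linear_compose by (metis funpow.simps(2))
qed

section \<open>The stable range of an operator\<close>

lemma ex_stable_range:
  assumes U: "Vector_Spaces.linear scale scale U"
  shows "\<exists>W. subspace W \<and> stable_range U W"
proof -
  \<comment> \<open>a power of least rank: applying \<open>U\<close> once more cannot shrink its range\<close>
  obtain k where k: "\<And>j. dim (range (U ^^ k)) \<le> dim (range (U ^^ j))"
    using ex_has_least_nat[of "\<lambda>_. True" 0 "\<lambda>k. dim (range (U ^^ k))"] by auto
  let ?W = "range (U ^^ k)"
  have sub: "subspace (range (U ^^ j))" for j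
    using endo.linear_subspace_image[OF linear_funpow[OF U] subspace_UNIV] .
  have img: "U ` ?W = range (U ^^ Suc k)"
    by (simp add: image_comp)
  have "range (U ^^ Suc k) \<subseteq> ?W"
    by (auto simp only: funpow_Suc_right o_apply)
  then have "range (U ^^ Suc k) = ?W"
    using subspace_dim_equal[OF sub sub] k by blast
  then have "stable_range U ?W"
    unfolding stable_range_def using img by (intro conjI exI[of _ k]) simp_all
  then show ?thesis using sub by blast
qed

text \<open>
  Each of two stable ranges contains the other: all powers of \<open>U\<close> map the first onto itself, and
  some power maps everything into the second.
\<close>

lemma stable_range_unique:
  assumes "stable_range U V" and "stable_range U W"
  shows "V = W"
proof -
  have "A \<subseteq> B" if A: "U ` A = A" and B: "stable_range U B" for A B
  proof -
    obtain k where k: "range (U ^^ k) \<subseteq> B"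
      using B by (auto simp: stable_range_def)
    have "(U ^^ k) ` A = A"
      using A by (rule funpow_image_eq)
    then show ?thesis using k by blast
  qed
  then show ?thesis
    using assms by (metis stable_range_def subset_antisym)
qed

text \<open>
  Operators inducing the same map on the quotient by \<open>W\<close> have powers doing so. This transports the condition that a power maps the whole space into \<open>W\<close>
  between \<open>T\<close> and \<open>U\<close>.
\<close>

lemma funpow_cong_mod_subspace:
  assumes S: "Vector_Spaces.linear scale scale S" and W: "subspace W" "S ` W \<subseteq> W"
    and diff: "\<And>v. S v - T v \<in> W"
  shows "(S ^^ k) v - (T ^^ k) v \<in> W"
proof (induction k)
  case 0
  then show ?case using W by (simp add: subspace_0)
next
  case (Suc k)
  have "(S ^^ Suc k) v - (T ^^ Suc k) v
      = S ((S ^^ k) v - (T ^^ k) v) + (S ((T ^^ k) v) - T ((T ^^ k) v))"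
    by (simp add: endo.linear_diff[OF S])
  moreover have "S ((S ^^ k) v - (T ^^ k) v) \<in> W"
    using Suc W by blast
  ultimately show ?case
    using W diff subspace_add by presburger
qed

section \<open>Bases adapted to a subspace\<close>

lemma ex_adapted_basis:
  assumes W: "subspace W"
  shows "\<exists>e C. adapted_basis W e C"
proof -
  obtain A where A: "A \<subseteq> W" "independent A" "W \<subseteq> span A" "card A = dim W"
    using basis_exists by blast
  have spA: "span A = W" using A W by (simp add: span_minimal subset_antisym)
  have "finite A" using A finiteI_independent by blast
  then obtain e where e: "bij_betw e {..<dim W} A"
    using A ex_bij_betw_nat_finite[of A] by (auto simp: atLeast0LessThan)
  obtain B where B: "A \<subseteq> B" "independent B" "UNIV \<subseteq> span B"
    using maximal_independent_subset_extend[of A UNIV] A by auto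
  have eA: "e ` {..<dim W} = A" and inj: "inj_on e {..<dim W}"
    using e by (auto simp: bij_betw_def)
  have "A \<union> (B - A) = B" using B by blast
  then have "adapted_basis W e (B - A)"
    unfolding adapted_basis_def using B eA inj spA by auto
  then show ?thesis by blast
qed

text \<open>
  A family of \<open>dim W\<close> vectors spanning \<open>W\<close> is a basis of \<open>W\<close>, and \<open>C\<close> spans a complement of \<open>W\<close>
  whichever basis of \<open>W\<close> it is combined with. The proof compares cardinalities with the dimension
  of the whole space, which gives injectivity, disjointness and independence at once.
\<close>

lemma adapted_basis_replace:
  assumes ad: "adapted_basis W e C" and f: "span (f ` {..<dim W}) = W"
  shows "adapted_basis W f C"
proof -
  let ?A = "e ` {..<dim W}" and ?A' = "f ` {..<dim W}"
  have e: "inj_on e {..<dim W}" "span ?A = W" "?A \<inter> C = {}"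
      "independent (?A \<union> C)" "span (?A \<union> C) = UNIV"
    using ad by (auto simp: adapted_basis_def)
  have finC: "finite C" using finiteI_independent[OF e(4)] by simp
  have "?A \<union> C \<subseteq> span (?A' \<union> C)"
    using e(2) f span_mono[of ?A' "?A' \<union> C"] span_superset[of ?A] span_superset[of "?A' \<union> C"]
    by auto
  then have sp: "span (?A' \<union> C) = UNIV"
    using e(5) span_minimal[OF _ subspace_span] by blast
  have cardA: "card ?A = dim W" using e(1) by (simp add: card_image)
  have n: "dim (UNIV :: 'b set) = dim W + card C"
    using basis_card_eq_dim[of "?A \<union> C" UNIV] e finC cardA
    by (simp add: card_Un_disjoint)
  have le: "card ?A' \<le> dim W" using card_image_le[of "{..<dim W}" f] by simp
  have int: "card ?A' + card C = card (?A' \<union> C) + card (?A' \<inter> C)"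
    using finC by (intro card_Un_Int) simp_all
  have ge: "card (?A' \<union> C) \<ge> dim W + card C"
    using span_card_ge_dim[of "?A' \<union> C" UNIV] sp finC n by simp
  have "independent (?A' \<union> C)"
    using card_le_dim_spanning[of "?A' \<union> C" UNIV] sp finC n le int by simp
  moreover have "card ?A' = dim W" and "card (?A' \<inter> C) = 0"
    using le int ge by linarith+
  then have "inj_on f {..<dim W}" "?A' \<inter> C = {}"
    using finC by (simp_all add: inj_on_iff_eq_card)
  ultimately show ?thesis
    unfolding adapted_basis_def using f sp by blast
qed

lemma adapted_basis_linear_extend:
  assumes "adapted_basis W e C"
  shows "\<exists>L. Vector_Spaces.linear scale scale L \<and> (\<forall>i<dim W. L (e i) = f i) \<and> (\<forall>c\<in>C. L c = g c)"
proof -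
  have e: "inj_on e {..<dim W}" "e ` {..<dim W} \<inter> C = {}" "independent (e ` {..<dim W} \<union> C)"
    using assms by (auto simp: adapted_basis_def)
  let ?h = "\<lambda>b. if b \<in> C then g b else f (the_inv_into {..<dim W} e b)"
  obtain L where L: "Vector_Spaces.linear scale scale L" "\<And>b. b \<in> e ` {..<dim W} \<union> C \<Longrightarrow> L b = ?h b"
    using endo.linear_independent_extend[OF e(3), of ?h] by blast
  have "L (e i) = f i" if "i < dim W" for i
    using L(2)[of "e i"] e that by (auto simp: the_inv_into_f_f)
  then show ?thesis using L by auto
qed

lemma adapted_basis_linear_eqI:
  assumes "adapted_basis W e C" "Vector_Spaces.linear scale scale S" "Vector_Spaces.linear scale scale T"
    and "\<And>i. i < dim W \<Longrightarrow> S (e i) = T (e i)" and "\<And>c. c \<in> C \<Longrightarrow> S c = T c"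
  shows "S = T"
proof
  fix v
  have "v \<in> span (e ` {..<dim W} \<union> C)"
    using assms(1) by (simp add: adapted_basis_def)
  then show "S v = T v"
    by (rule endo.linear_eq_on[OF assms(2,3)]) (use assms(4,5) in auto)
qed

section \<open>Orbits of nilpotent operators\<close>

text \<open>
  Let \<open>d\<close> be least with \<open>T\<^sup>d x = 0\<close>. The tails \<open>{T\<^sup>i x | j \<le> i < d}\<close> are independent, by descending
  induction on \<open>j\<close>: as \<open>T\<close> maps the span of each tail onto the span of the next, \<open>T\<^sup>j x\<close> lying in the
  span of the next tail would make the span of the tail at \<open>j\<close> equal to its own image under \<open>T\<close>, hence
  zero by nilpotency. Therefore \<open>d\<close> is the dimension of the cyclic subspace.
\<close>

lemma nilpotent_cyclic_basis:
  fixes x :: 'b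
  assumes T: "Vector_Spaces.linear scale scale T" and nil: "nilpotent T"
  defines "W \<equiv> cyclic_subspace T x"
  shows "span ((\<lambda>i. (T ^^ i) x) ` {..<dim W}) = W" and "(T ^^ dim W) x = 0"
proof -
  define d where "d = (LEAST d. (T ^^ d) x = 0)"
  obtain n where n: "T ^^ n = (\<lambda>x. 0)" using nil by (auto simp: nilpotent_def)
  then have d0: "(T ^^ d) x = 0"
    unfolding d_def by (metis (mono_tags, lifting) LeastI)
  have ne: "(T ^^ i) x \<noteq> 0" if "i < d" for i
    using that unfolding d_def by (rule not_less_Least)
  have zero: "(T ^^ i) x = 0" if "i \<ge> d" for i
  proof -
    have "(T ^^ i) x = (T ^^ (i - d)) ((T ^^ d) x)"
      using that by (metis comp_apply funpow_add le_add_diff_inverse2)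
    then show ?thesis
      by (simp add: d0 endo.linear_0[OF linear_funpow[OF T]])
  qed
  define tail where "tail j = (\<lambda>i. (T ^^ i) x) ` {j..<d}" for j
  have tail_Suc: "tail j = insert ((T ^^ j) x) (tail (Suc j))" if "j < d" for j
  proof -
    have "{j..<d} = insert j {Suc j..<d}" using that by auto
    then show ?thesis by (simp add: tail_def)
  qed
  have shift: "T ` span (tail j) = span (tail (Suc j))" for j
  proof -
    \<comment> \<open>\<open>T\<close> sends the last vector of a tail to \<open>0\<close>, which is why \<open>0\<close> is inserted\<close>
    have "insert 0 (T ` tail j) = insert 0 (tail (Suc j))"
    proof -
      have "T ((T ^^ i) x) \<in> insert 0 (tail (Suc j))" if "i \<in> {j..<d}" for i
        using that zero[of "Suc i"] by (cases "Suc i < d") (force simp: tail_def)+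
      moreover have "(T ^^ i) x \<in> T ` tail j" if "i \<in> {Suc j..<d}" for i
        using that by (cases i) (auto simp: tail_def)
      ultimately show ?thesis unfolding tail_def by blast
    qed
    then show ?thesis
      using endo.linear_span_image[OF T, of "tail j"] by (metis span_insert_0)
  qed
  have notin: "(T ^^ j) x \<notin> span (tail (Suc j))" if "j < d" for j
  proof
    assume "(T ^^ j) x \<in> span (tail (Suc j))"
    then have "T ` span (tail j) = span (tail j)"
      using shift tail_Suc[OF that] span_redundant by metis
    then have "(T ^^ k) ` span (tail j) = span (tail j)" for k
      by (rule funpow_image_eq)
    from this[of n] have "span (tail j) \<subseteq> {0}"
      using n by auto
    then show False
      using ne[OF that] span_superset tail_Suc[OF that] by blast
  qed
  \<comment> \<open>descending induction on \<open>j = d - k\<close>; truncation makes the claim constant from \<open>k = d\<close> on\<close>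
  have basis: "independent (tail (d - k)) \<and> card (tail (d - k)) = min k d" for k
  proof (induction k)
    case 0
    then show ?case by (simp add: tail_def independent_empty)
  next
    case (Suc k)
    show ?case
    proof (cases "k < d")
      case True
      have j: "Suc (d - Suc k) = d - k" "d - Suc k < d" using True by auto
      have "(T ^^ (d - Suc k)) x \<notin> tail (d - k)"
        using notin[OF j(2)] span_superset by (metis j(1) subsetD)
      then show ?thesis
        using Suc True notin[OF j(2)] tail_Suc[OF j(2)] independent_insertI
        by (simp add: j(1) card_insert_if tail_def)
    qed (use Suc in auto)
  qed
  have "insert 0 (range (\<lambda>i. (T ^^ i) x)) = insert 0 (tail 0)"
  proof -
    have "(T ^^ i) x \<in> insert 0 (tail 0)" for i
      using zero[of i] by (cases "i < d") (auto simp: tail_def)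
    then show ?thesis by (auto simp: tail_def)
  qed
  then have sp: "span (tail 0) = W"
    unfolding W_def cyclic_subspace_def by (metis span_insert_0)
  have "dim W = d"
    using basis[of d] dim_span_eq_card_independent[of "tail 0"] sp by simp
  then show "span ((\<lambda>i. (T ^^ i) x) ` {..<dim W}) = W" and "(T ^^ dim W) x = 0"
    using sp d0 by (simp_all add: tail_def atLeast0LessThan)
qed

lemma cyclic_subspace_invariant:
  assumes T: "Vector_Spaces.linear scale scale T"
  shows "T ` cyclic_subspace T x \<subseteq> cyclic_subspace T x"
proof -
  have "T ` range (\<lambda>i. (T ^^ i) x) \<subseteq> range (\<lambda>i. (T ^^ i) x)"
    by (auto intro: range_eqI[of _ _ "Suc _"])
  then show ?thesis
    unfolding cyclic_subspace_def
    using endo.linear_span_image[OF T] span_mono by metis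
qed

section \<open>The matching is bijective\<close>

lemma diff_in_subspace_if_eq_on_complement:
  assumes ad: "adapted_basis W e C" and W: "subspace W"
    and T: "Vector_Spaces.linear scale scale T" "T ` W \<subseteq> W" and U: "Vector_Spaces.linear scale scale U" "U ` W \<subseteq> W"
    and C: "\<And>c. c \<in> C \<Longrightarrow> U c = T c"
  shows "U v - T v \<in> W"
proof -
  let ?A = "e ` {..<dim W}"
  have D: "Vector_Spaces.linear scale scale (\<lambda>v. U v - T v)"
    using U(1) T(1) by (rule endo.linear_compose_sub)
  have "?A \<subseteq> W"
    using ad span_superset by (metis adapted_basis_def)
  then have "U b - T b \<in> W" if "b \<in> ?A" for b
    using that T(2) U(2) by (intro subspace_diff[OF W]) auto
  then have "U b - T b \<in> W" if "b \<in> ?A \<union> C" for b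
    using that C subspace_0[OF W] by auto
  then have "span ((\<lambda>v. U v - T v) ` (?A \<union> C)) \<subseteq> W"
    by (intro span_minimal[OF _ W]) blast
  then have "(\<lambda>v. U v - T v) ` span (?A \<union> C) \<subseteq> W"
    by (simp only: endo.linear_span_image[OF D])
  moreover have "v \<in> span (?A \<union> C)" using ad by (simp add: adapted_basis_def)
  ultimately show ?thesis by blast
qed

lemma stable_range_if_correspond:
  assumes ad: "adapted_basis (cyclic_subspace T x) e C"
    and T: "Vector_Spaces.linear scale scale T" "nilpotent T" and U: "Vector_Spaces.linear scale scale U"
    and sw: "correspond (cyclic_subspace T x) e C T x U"
  shows "stable_range U (cyclic_subspace T x)"
proof -
  let ?W = "cyclic_subspace T x"
  let ?A = "e ` {..<dim ?W}"
  have sub: "subspace ?W" by (simp add: cyclic_subspace_def)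
  have "U ` ?A = (\<lambda>i. (T ^^ i) x) ` {..<dim ?W}"
    using sw by (auto simp: correspond_def image_image)
  moreover have "span ?A = ?W" using ad by (simp add: adapted_basis_def)
  ultimately have UW: "U ` ?W = ?W"
    using endo.linear_span_image[OF U, of ?A] nilpotent_cyclic_basis(1)[OF T, of x] by simp
  have diff: "U v - T v \<in> ?W" for v
    using diff_in_subspace_if_eq_on_complement[OF ad sub T(1) cyclic_subspace_invariant[OF T(1)] U] UW sw
    by (auto simp: correspond_def)
  obtain k where k: "T ^^ k = (\<lambda>x. 0)" using T(2) by (auto simp: nilpotent_def)
  have "(U ^^ k) v \<in> ?W" for v
    using funpow_cong_mod_subspace[OF U sub _ diff, of k v] UW k by simp
  then show ?thesis unfolding stable_range_def using UW by blast
qed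

text \<open>
  The operator \<open>U\<close> determines the first \<open>dim W\<close> vectors of the orbit of \<open>x\<close>, and the next one is
  \<open>0\<close>. So \<open>U\<close> determines \<open>T\<close> on the basis consisting of these vectors and \<open>C\<close>.
\<close>

lemma correspond_inj:
  assumes ad: "adapted_basis W e C"
    and T: "Vector_Spaces.linear scale scale T" "nilpotent T" "cyclic_subspace T x = W"
    and S: "Vector_Spaces.linear scale scale S" "nilpotent S" "cyclic_subspace S y = W"
    and sw: "correspond W e C T x U" "correspond W e C S y U"
  shows "T = S \<and> x = y"
proof
  let ?f = "\<lambda>i. (T ^^ i) x"
  have eq: "(T ^^ i) x = (S ^^ i) y" if "i < dim W" for i
    using sw that by (simp add: correspond_def)
  have ad': "adapted_basis W ?f C"
    using adapted_basis_replace[OF ad] nilpotent_cyclic_basis(1)[OF T(1,2), of x] T(3) by simp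
  have end0: "(T ^^ dim W) x = 0" "(S ^^ dim W) y = 0"
    using nilpotent_cyclic_basis(2)[OF T(1,2), of x] nilpotent_cyclic_basis(2)[OF S(1,2), of y]
      T(3) S(3) by simp_all
  have eq': "(T ^^ Suc i) x = (S ^^ Suc i) y" if "i < dim W" for i
    using eq[of "Suc i"] end0 that by (cases "Suc i = dim W") auto
  show "T = S"
    by (rule adapted_basis_linear_eqI[OF ad' T(1) S(1)])
      (use eq eq' sw in \<open>auto simp: correspond_def\<close>)
  \<comment> \<open>for \<open>W = {0}\<close> the orbit condition is void and only \<open>x \<in> W\<close> determines \<open>x\<close>\<close>
  show "x = y"
  proof (cases "dim W = 0")
    case True
    have "x \<in> W" "y \<in> W"
      using T(3) S(3) span_superset unfolding cyclic_subspace_def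
      by (metis funpow_0 rangeI subsetD)+
    then show ?thesis using True by auto
  next
    case False
    then show ?thesis using eq[of 0] by (simp del: dim_eq_0)
  qed
qed

text \<open>
  The images \<open>U (e i)\<close> form a basis of \<open>W\<close>. Let \<open>T\<close> shift each of them to the next and the last one
  to \<open>0\<close>, and let \<open>T\<close> agree with \<open>U\<close> on \<open>C\<close>. Some power of \<open>T\<close> maps the space into \<open>W\<close>, because
  some power of \<open>U\<close> does, and \<open>dim W\<close> further steps kill \<open>W\<close>.
\<close>

lemma correspond_surj:
  assumes ad: "adapted_basis W e C" and W: "subspace W"
    and U: "Vector_Spaces.linear scale scale U" "stable_range U W"
  shows "\<exists>T x. Vector_Spaces.linear scale scale T \<and> nilpotent T \<and>
    cyclic_subspace T x = W \<and> correspond W e C T x U"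
proof -
  let ?m = "dim W"
  \<comment> \<open>continued by \<open>0\<close>, so that \<open>T (f i) = f (Suc i)\<close> for all \<open>i\<close>; for \<open>W = {0}\<close> the vector \<open>f 0\<close> is \<open>0\<close>\<close>
  define f where "f i = (if i < ?m then U (e i) else 0)" for i
  have UW: "U ` W = W" using U(2) by (simp add: stable_range_def)
  have fU: "f ` {..<?m} = U ` e ` {..<?m}" by (auto simp: f_def image_image)
  have spf: "span (f ` {..<?m}) = W"
    using endo.linear_span_image[OF U(1), of "e ` {..<?m}"] ad UW fU by (simp add: adapted_basis_def)
  have ad': "adapted_basis W f C"
    using adapted_basis_replace[OF ad spf] .
  obtain T where T: "Vector_Spaces.linear scale scale T" "\<And>i. i < ?m \<Longrightarrow> T (f i) = f (Suc i)"
      "\<And>c. c \<in> C \<Longrightarrow> T c = U c"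
    using adapted_basis_linear_extend[OF ad', of "\<lambda>i. f (Suc i)" U] by blast
  have Tf: "T (f i) = f (Suc i)" for i
    using T(2)[of i] endo.linear_0[OF T(1)] by (cases "i < ?m") (simp_all add: f_def)
  have Tpow: "(T ^^ k) (f i) = f (i + k)" for k i
    by (induction k) (simp_all add: Tf)
  have "range f \<subseteq> insert 0 (f ` {..<?m})" by (auto simp: f_def)
  then have "span (range f) = W"
    using spf span_mono[of "f ` {..<?m}" "range f"] span_mono[of "range f" "insert 0 (f ` {..<?m})"]
    by (auto simp: span_insert_0)
  then have cyc: "cyclic_subspace T (f 0) = W"
    by (simp add: cyclic_subspace_def Tpow)
  have TW: "T ` W \<subseteq> W"
    using cyclic_subspace_invariant[OF T(1), of "f 0"] cyc by simp
  have sw: "correspond W e C T (f 0) U"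
    using T(3) by (simp add: correspond_def Tpow) (simp add: f_def)
  have diff: "T v - U v \<in> W" for v
    using diff_in_subspace_if_eq_on_complement[OF ad W U(1) _ T(1) TW] UW T(3) by auto
  obtain k where k: "range (U ^^ k) \<subseteq> W" using U(2) by (auto simp: stable_range_def)
  have inW: "(T ^^ k) v \<in> W" for v
    using funpow_cong_mod_subspace[OF T(1) W TW diff, of k v] k subspace_add[OF W]
    by (metis diff_add_cancel rangeI subsetD)
  have kill: "(T ^^ ?m) w = 0" if "w \<in> W" for w
  proof -
    have "w \<in> span (f ` {..<?m})" using that spf by simp
    then show ?thesis
      by (rule endo.linear_eq_0_on_span[OF linear_funpow[OF T(1)], rotated])
        (auto simp: Tpow, simp add: f_def)
  qed
  have "T ^^ (?m + k) = (\<lambda>x. 0)"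
    using kill inW by (auto simp: funpow_add)
  then have "nilpotent T" unfolding nilpotent_def by blast
  then show ?thesis using T(1) cyc sw by blast
qed

lemma ex_bij_betw_nilpotent_vector_linear:
  "\<exists>F. bij_betw F (Nil_ops scale \<times> (UNIV :: 'b set)) (Lin scale)"
proof -
  obtain e C where ad: "\<And>W. subspace W \<Longrightarrow> adapted_basis W (e W) (C W)"
    using ex_adapted_basis by metis
  let ?cyc = "\<lambda>T x. cyclic_subspace T x"
  have sub: "subspace (?cyc T x)" for T x by (simp add: cyclic_subspace_def)
  have "\<exists>U. Vector_Spaces.linear scale scale U \<and>
      correspond (?cyc T x) (e (?cyc T x)) (C (?cyc T x)) T x U" for T x
    using adapted_basis_linear_extend[OF ad[OF sub], of T x "\<lambda>i. (T ^^ i) x" T]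
    unfolding correspond_def .
  then obtain F where F: "\<And>T x. Vector_Spaces.linear scale scale (F T x)"
      "\<And>T x. correspond (?cyc T x) (e (?cyc T x)) (C (?cyc T x)) T x (F T x)"
    by metis
  have stable: "stable_range (F T x) (?cyc T x)"
    if "Vector_Spaces.linear scale scale T" "nilpotent T" for T x
    using stable_range_if_correspond[OF ad[OF sub] that F] .
  have "bij_betw (\<lambda>(T, x). F T x) (Nil_ops scale \<times> UNIV) (Lin scale)"
    unfolding bij_betw_def
  proof
    show "inj_on (\<lambda>(T, x). F T x) (Nil_ops scale \<times> UNIV)"
    proof (rule inj_onI, clarsimp simp: Nil_ops_def Lin_def)
      fix T x S y
      assume T: "Vector_Spaces.linear scale scale T" "nilpotent T"
        and S: "Vector_Spaces.linear scale scale S" "nilpotent S"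
        and eq: "F T x = F S y"
      have cyc: "?cyc S y = ?cyc T x"
        using stable_range_unique stable[OF T, of x] stable[OF S, of y] eq by metis
      have "correspond (?cyc T x) (e (?cyc T x)) (C (?cyc T x)) S y (F T x)"
        using F(2)[of S y] unfolding cyc eq .
      then show "T = S \<and> x = y"
        by (rule correspond_inj[OF ad[OF sub] T refl S cyc F(2)])
    qed
    show "(\<lambda>(T, x). F T x) ` (Nil_ops scale \<times> UNIV) = Lin scale"
    proof
      show "(\<lambda>(T, x). F T x) ` (Nil_ops scale \<times> UNIV) \<subseteq> Lin scale"
        using F(1) by (auto simp: Lin_def)
      show "Lin scale \<subseteq> (\<lambda>(T, x). F T x) ` (Nil_ops scale \<times> UNIV)"
      proof
        fix U assume "U \<in> Lin scale"
        then have U: "Vector_Spaces.linear scale scale U" by (simp add: Lin_def)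
        obtain W where W: "subspace W" "stable_range U W" using ex_stable_range[OF U] by blast
        obtain T x where T: "Vector_Spaces.linear scale scale T" "nilpotent T" "?cyc T x = W"
            "correspond W (e W) (C W) T x U"
          using correspond_surj[OF ad[OF W(1)] W(1) U W(2)] by blast
        have "F T x = U"
          by (rule adapted_basis_linear_eqI[OF ad[OF W(1)] F(1) U])
            (use T(3,4) F(2)[of T x] in \<open>auto simp: correspond_def\<close>)
        then show "U \<in> (\<lambda>(T, x). F T x) ` (Nil_ops scale \<times> UNIV)"
          using T by (force simp: Nil_ops_def Lin_def)
      qed
    qed
  qed
  then show ?thesis by (intro exI)
qed

end

theorem theorem5:
  fixes scale :: "'a::field \<Rightarrow> 'b::ab_group_add \<Rightarrow> 'b" and Basis :: "'b set"
  assumes "finite_dimensional_vector_space scale Basis"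
  shows "\<exists>f. bij_betw f (Nil_ops scale \<times> (UNIV :: 'b set)) (Lin scale)"
  using assms by (rule finite_dimensional_vector_space.ex_bij_betw_nilpotent_vector_linear)

end
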